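(* Let $A,B,C$ be three non-collinear points in the Euclidean plane, and let $x,y,z,u,v,w\in\mathbb{R}\cup\{\infty\}$ be such that each of the pairs of cevians $(AA_x,BB_v)$, $(BB_y,CC_w)$, $(CC_z,AA_u)$ intersects at exactly one point (equivalently, $(1+x+xv)(1+y+yw)(1+z+zu)\neq 0$, with the convention for $\infty$ given in the context). Define the points $P,Q,R$ by $$\{P\}=AA_x\cap BB_v,\qquad \{Q\}=BB_y\cap CC_w,\qquad \{R\}=CC_z\cap AA_u .$$ Then $P$, $Q$ and $R$ are collinear if and only if $$1-xyw-xvz-uyz+xyz+xyzuvw=0,$$ where, if some of the parameters equal $\infty$, this equation is understood to mean that the extension by continuity of the quotient $$\frac{1-xyw-xvz-uyz+xyz+xyzuvw}{(1+x+xv)(1+y+yw)(1+z+zu)}$$ from the real $6$-tuples at which the denominator is nonzero takes the value $0$ at $(x,y,z,u,v,w)$.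
   Context: Cevians. Let $A,B,C$ be non-collinear points in the Euclidean plane. For $x\in\mathbb{R}\setminus\{-1\}$, $A_x$ is the unique point on the line $BC$ with $\overrightarrow{BA_x}=x\,\overrightarrow{A_xC}$ (so $A_0=B$), and $A_\infty=C$. For $x\in(\mathbb{R}\cup\{\infty\})\setminus\{-1\}$, $AA_x$ denotes the line through $A$ and $A_x$; $AA_{-1}$ denotes the line through $A$ parallel to $BC$. Similarly, for $y\in\mathbb{R}\setminus\{-1\}$, $B_y$ is the unique point on the line $CA$ with $\overrightarrow{CB_y}=y\,\overrightarrow{B_yA}$ (so $B_0=C$), $B_\infty=A$, $BB_y$ is the line through $B$ and $B_y$, and $BB_{-1}$ is the line through $B$ parallel to $CA$. For $z\in\mathbb{R}\setminus\{-1\}$, $C_z$ is the unique point on the line $AB$ with $\overrightarrow{AC_z}=z\,\overrightarrow{C_zB}$ (so $C_0=A$), $C_\infty=B$, $CC_z$ is the line through $C$ and $C_z$, and $CC_{-1}$ is the line through $C$ parallel to $AB$. All these lines are called cevians. Convention for $\infty$. $\mathbb{R}\cup\{\infty\}$ carries the topology of the one-point compactification of $\mathbb{R}$. For $s,t\in\mathbb{R}\cup\{\infty\}$ not both real, $1+s+st=0$ is considered to hold exactly when $(s,t)=(\infty,-1)$ or $(s,t)=(0,\infty)$ (these are the points with an infinite entry in the closure of the real solution set). The condition $(1+x+xv)(1+y+yw)(1+z+zu)\neq0$ means that none of the three factors vanishes in this sense. Three points are called collinear if some line contains all of them; points that coincide are allowed. *)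

theory Defs
  imports "HOL-Analysis.Analysis"
begin

text \<open>The set \<open>\<real> \<union> {\<infinity>}\<close> is rendered as \<^typ>\<open>real option\<close>, with \<open>None\<close> in the role of \<open>\<infinity>\<close>. Its
  topology is the library's one-point compactification of \<open>\<real>\<close>.\<close>

type_synonym xreal = "real option"

abbreviation xreal_topology :: "xreal topology" where
  "xreal_topology \<equiv> Alexandroff_compactification (euclidean :: real topology)"

text \<open>\<open>foot B C s\<close> is the point on the line \<open>BC\<close> dividing the segment from \<open>B\<close> to \<open>C\<close> in the
  ratio \<open>s\<close>. It is meaningful for \<open>B \<noteq> C\<close> and \<open>s \<noteq> -1\<close> only. With vertices \<open>A, B, C\<close>,
  \<open>A\<^sub>x = foot B C x\<close>, \<open>B\<^sub>y = foot C A y\<close> and \<open>C\<^sub>z = foot A B z\<close>.\<close>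

definition foot :: "real^2 \<Rightarrow> real^2 \<Rightarrow> xreal \<Rightarrow> real^2" where
  "foot B C s = (case s of
      None \<Rightarrow> C
    | Some x \<Rightarrow> (THE X. X \<in> affine hull {B, C} \<and> X - B = x *\<^sub>R (C - X)))"

text \<open>\<open>cevian A B C s\<close> is the cevian from the vertex \<open>A\<close> to the opposite side, oriented from \<open>B\<close>
  to \<open>C\<close>. So \<open>AA\<^sub>x = cevian A B C x\<close>, \<open>BB\<^sub>y = cevian B C A y\<close> and \<open>CC\<^sub>z = cevian C A B z\<close>.\<close>

definition cevian :: "real^2 \<Rightarrow> real^2 \<Rightarrow> real^2 \<Rightarrow> xreal \<Rightarrow> (real^2) set" where
  "cevian A B C s =
     (if s = Some (-1) then {A + t *\<^sub>R (C - B) | t. True}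
      else affine hull {A, foot B C s})"

text \<open>The condition \<open>1 + s + s t = 0\<close>, where for infinite entries it holds only at \<open>(\<infinity>, -1)\<close>
  and \<open>(0, \<infinity>)\<close>.\<close>

fun factor_vanishes :: "xreal \<Rightarrow> xreal \<Rightarrow> bool" where
  "factor_vanishes (Some s) (Some t) \<longleftrightarrow> 1 + s + s * t = 0"
| "factor_vanishes None t \<longleftrightarrow> t = Some (-1)"
| "factor_vanishes (Some s) None \<longleftrightarrow> s = 0"

text \<open>All 6-tuples are in the order \<open>(x, y, z, u, v, w)\<close>.\<close>

type_synonym 'a six = "'a \<times> 'a \<times> 'a \<times> 'a \<times> 'a \<times> 'a"

definition numer :: "real six \<Rightarrow> real" where
  "numer = (\<lambda>(x, y, z, u, v, w).
     1 - x * y * w - x * v * z - u * y * z + x * y * z + x * y * z * u * v * w)"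

definition denom :: "real six \<Rightarrow> real" where
  "denom = (\<lambda>(x, y, z, u, v, w). (1 + x + x * v) * (1 + y + y * w) * (1 + z + z * u))"

definition some6 :: "real six \<Rightarrow> xreal six" where
  "some6 = (\<lambda>(x, y, z, u, v, w). (Some x, Some y, Some z, Some u, Some v, Some w))"

abbreviation xreal_six_topology :: "xreal six topology" where
  "xreal_six_topology \<equiv>
     prod_topology xreal_topology (prod_topology xreal_topology (prod_topology xreal_topology
       (prod_topology xreal_topology (prod_topology xreal_topology xreal_topology))))"

text \<open>The filter of real 6-tuples with nonzero denominator that approach the point \<open>p\<close> of
  \<open>(\<real> \<union> {\<infinity>})\<^sup>6\<close>.\<close>

definition approach :: "xreal six \<Rightarrow> real six filter" where
  "approach p =
     inf (filtercomap some6 (nhdsin xreal_six_topology p)) (principal {q. denom q \<noteq> 0})"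

text \<open>The extension by continuity of \<open>numer / denom\<close> takes the value \<open>l\<close> at \<open>p\<close>.\<close>

definition quotient_extends_to :: "xreal six \<Rightarrow> real \<Rightarrow> bool" where
  "quotient_extends_to p l \<longleftrightarrow> ((\<lambda>q. numer q / denom q) \<longlongrightarrow> l) (approach p)"

definition equation_holds :: "xreal six \<Rightarrow> bool" where
  "equation_holds p \<longleftrightarrow>
     (\<exists>q. p = some6 q \<and> numer q = 0) \<or> (p \<notin> range some6 \<and> quotient_extends_to p 0)"

end

(* In barycentric coordinates (a : b : c) with respect to A, B, C and with x = x1 / x0 written
   homogeneously, the cevian AA_x is x0 c = x1 b, also for x = -1 and for infinite x. Hence
   P = (x1 v1 : x0 v0 : x1 v0), and the sum of these coordinates is the homogenised factor
   1 + x + x v; a unique intersection point exists exactly when it is nonzero. The quotient in the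
   theorem is the determinant of the normalised coordinates of P, Q, R. Being homogeneous of
   degree 0 in each pair (x0, x1), it extends continuously to infinite parameters, and its
   vanishing there still expresses collinearity. *)

theory Submission
  imports Defs
begin

section \<open>Homogeneous parameters and barycentric coordinates\<close>

text \<open>\<open>hom0 s\<close> and \<open>hom1 s\<close> are homogeneous coordinates with \<open>s = hom1 s / hom0 s\<close>.\<close>

definition hom0 :: "xreal \<Rightarrow> real" where
  "hom0 s = (case s of None \<Rightarrow> 0 | Some _ \<Rightarrow> 1)"

definition hom1 :: "xreal \<Rightarrow> real" where
  "hom1 s = (case s of None \<Rightarrow> 1 | Some a \<Rightarrow> a)"

lemma hom_simps [simp]:
  "hom0 None = 0" "hom0 (Some a) = 1" "hom1 None = 1" "hom1 (Some a) = a"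
  by (simp_all add: hom0_def hom1_def)

lemma hom_nonzero: "hom0 s \<noteq> 0 \<or> hom1 s \<noteq> 0"
  by (cases s) auto

definition hden :: "xreal \<Rightarrow> xreal \<Rightarrow> real" where
  "hden s t = hom0 s * hom0 t + hom1 s * hom0 t + hom1 s * hom1 t"

text \<open>At \<open>s = None\<close> the form \<open>hden\<close> is
  \<open>hom0 t + hom1 t\<close>, and at finite \<open>s\<close> with \<open>t = None\<close> it is
  \<open>hom1 s\<close>; the convention for infinity is thus the vanishing of one
  polynomial.\<close>

lemma factor_vanishes_iff: "factor_vanishes s t \<longleftrightarrow> hden s t = 0"
  by (cases s; cases t) (auto simp: hden_def add_eq_0_iff algebra_simps)

definition bary :: "real^2 \<Rightarrow> real^2 \<Rightarrow> real^2 \<Rightarrow> real \<Rightarrow> real \<Rightarrow> real \<Rightarrow> real^2" where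
  "bary A B C a b c = a *\<^sub>R A + b *\<^sub>R B + c *\<^sub>R C"

text \<open>Transfers results about the cevians from \<open>A\<close> and \<open>B\<close> to the
  other two pairs by cyclic relabelling.\<close>

lemma bary_rotate: "bary B C A b c a = bary A B C a b c"
  by (simp add: bary_def add_ac)

lemma not_collinear_rotate:
  "\<not> collinear {A, B, C} \<Longrightarrow> \<not> collinear {B, C, A :: real^2}"
  by (simp add: insert_commute)

text \<open>The coefficient differences sum to zero, so equality of the points becomes a linear
  relation between \<open>B - A\<close> and \<open>C - A\<close>, which are independent.\<close>

lemma bary_inject:
  assumes nc: "\<not> collinear {A, B, C}" and eq: "bary A B C a b c = bary A B C a' b' c'"
    and "a + b + c = 1" "a' + b' + c' = 1"
  shows "a = a' \<and> b = b' \<and> c = c'"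
proof -
  define p q r where "p = a - a'" and "q = b - b'" and "r = c - c'"
  have 0: "p *\<^sub>R A + q *\<^sub>R B + r *\<^sub>R C = 0"
    using eq by (simp add: bary_def p_def q_def r_def algebra_simps)
  have s: "p = - q - r"
    using assms(3,4) by (simp add: p_def q_def r_def)
  have 1: "q *\<^sub>R (B - A) = (- r) *\<^sub>R (C - A)"
    using 0 unfolding s by (simp add: algebra_simps)
  have AC: "A \<noteq> C" and AB: "A \<noteq> B"
    using nc by (auto simp: insert_commute)
  have "q = 0"
  proof (rule ccontr)
    assume "q \<noteq> 0"
    then have "B - A = (1/q) *\<^sub>R (q *\<^sub>R (B - A))" by simp
    also have "\<dots> = (- r / q) *\<^sub>R (C - A)" unfolding 1 by simp
    finally have "B = (1 + r/q) *\<^sub>R A + (1 - (1 + r/q)) *\<^sub>R C"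
      by (simp add: algebra_simps)
    then have "collinear {A, B, C}"
      unfolding collinear_3_expand by blast
    with nc show False by simp
  qed
  moreover from this 1 AC have "r = 0" by auto
  ultimately show ?thesis using s by (simp add: p_def q_def r_def)
qed

section \<open>Cevians and their intersections\<close>

text \<open>Multiplying by \<open>hom0 s + hom1 s\<close> clears the division, so finite and
  infinite feet obey one formula. This factor is zero only at -1, where the cevian is a
  parallel.\<close>

lemma foot_eq:
  assumes "B \<noteq> C" "hom0 s + hom1 s \<noteq> 0"
  shows "(hom0 s + hom1 s) *\<^sub>R foot B C s = hom0 s *\<^sub>R B + hom1 s *\<^sub>R C"
proof (cases s)
  case None
  then show ?thesis by (simp add: foot_def)
next
  case (Some x)
  define F where "F = (1 / (1 + x)) *\<^sub>R B + (x / (1 + x)) *\<^sub>R C"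
  have x: "1 + x \<noteq> 0" using assms Some by simp
  \<comment> \<open>The ratio equation is linear in \<open>X\<close> with leading coefficient
    \<open>1 + x\<close>, so \<open>F\<close> is its only solution.\<close>
  have uniq: "X - B = x *\<^sub>R (C - X) \<longleftrightarrow> X = F" for X
  proof -
    have "X - B = x *\<^sub>R (C - X) \<longleftrightarrow> (1 + x) *\<^sub>R X = B + x *\<^sub>R C"
      by (auto simp: algebra_simps)
    also have "\<dots> \<longleftrightarrow> (1 + x) *\<^sub>R X = (1 + x) *\<^sub>R F"
      using x by (simp add: F_def scaleR_add_right)
    also have "\<dots> \<longleftrightarrow> X = F" using x by simp
    finally show ?thesis .
  qed
  have "F \<in> affine hull {B, C}"
    unfolding affine_hull_2 F_def using x
    by (intro CollectI exI[of _ "1 / (1 + x)"] exI[of _ "x / (1 + x)"])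
      (simp add: add_divide_distrib[symmetric])
  then have "foot B C s = F"
    unfolding foot_def Some by (auto simp: uniq)
  then show ?thesis
    using x by (simp add: Some F_def scaleR_add_right)
qed

text \<open>A line through \<open>A\<close> fixes the ratio of \<open>b\<close> to \<open>c\<close>,
  and the foot gives it as \<open>hom0 s : hom1 s\<close>. At -1 the equation reads
  \<open>c = - b\<close>, hence \<open>a = 1\<close>, which is the parallel to
  \<open>BC\<close>.\<close>

lemma cevian_eq:
  assumes "B \<noteq> C"
  shows "cevian A B C s =
    {bary A B C a b c | a b c. a + b + c = 1 \<and> hom0 s * c = hom1 s * b}"
proof (cases "hom0 s + hom1 s = 0")
  case True
  then have s: "s = Some (-1)" by (cases s) auto
  show ?thesis
    unfolding cevian_def s
  proof (auto, goal_cases)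
    case (1 t)
    \<comment> \<open>The point \<open>A + t *\<^sub>R (C - B)\<close> has coordinates
      \<open>(1, -t, t)\<close>.\<close>
    show ?case
      by (intro exI[of _ "- t"]) (simp add: bary_def algebra_simps)
  next
    case (2 b)
    then show ?case
      by (intro exI[of _ "- b"]) (simp add: bary_def algebra_simps)
  qed
next
  case False
  define k where "k = hom0 s + hom1 s"
  have k: "k \<noteq> 0" using False by (simp add: k_def)
  have s: "s \<noteq> Some (-1)" using False by auto
  have foot: "foot B C s = (hom0 s / k) *\<^sub>R B + (hom1 s / k) *\<^sub>R C"
  proof -
    have "foot B C s = (1 / k) *\<^sub>R (k *\<^sub>R foot B C s)" using k by simp
    also have "\<dots> = (hom0 s / k) *\<^sub>R B + (hom1 s / k) *\<^sub>R C"
      using foot_eq[OF assms False] by (simp add: k_def scaleR_add_right)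
    finally show ?thesis .
  qed
  have "affine hull {A, foot B C s} =
    {bary A B C a b c | a b c. a + b + c = 1 \<and> hom0 s * c = hom1 s * b}"
  proof (auto simp: affine_hull_2, goal_cases)
    case (1 a t)
    have "a + t * hom0 s / k + t * hom1 s / k = 1"
    proof -
      have "t * hom0 s / k + t * hom1 s / k = t * k / k"
        by (simp add: k_def add_divide_distrib distrib_left)
      then show ?thesis using 1 k by simp
    qed
    then show ?case
      by (intro exI[of _ a] exI[of _ "t * hom0 s / k"] exI[of _ "t * hom1 s / k"])
        (simp add: bary_def foot scaleR_add_right)
  next
    case (2 a b c)
    \<comment> \<open>The foot carries the weight \<open>b + c\<close>, which the line equation
      splits between \<open>B\<close> and \<open>C\<close>.\<close>
    have "(b + c) * hom0 s / k = b" "(b + c) * hom1 s / k = c"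
      using 2 k by (simp_all add: k_def field_simps)
    then show ?case
      using 2 by (intro exI[of _ a] exI[of _ "b + c"]) (simp add: bary_def foot scaleR_add_right)
  qed
  then show ?thesis using s by (simp add: cevian_def)
qed

lemma cevians_Int:
  assumes nc: "\<not> collinear {A, B, C}"
  shows "cevian A B C s \<inter> cevian B C A t =
    {bary A B C a b c | a b c. a + b + c = 1 \<and> hom0 s * c = hom1 s * b \<and> hom0 t * a = hom1 t * c}"
    (is "?L = ?R")
proof -
  have ne: "B \<noteq> C" "C \<noteq> A" using nc by (auto simp: insert_commute)
  show ?thesis
  proof
    show "?L \<subseteq> ?R"
    proof
      fix X assume "X \<in> ?L"
      then obtain a b c a' b' c' where 1: "X = bary A B C a b c" "a + b + c = 1"
        "hom0 s * c = hom1 s * b" and 2: "X = bary B C A b' c' a'" "b' + c' + a' = 1"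
        "hom0 t * a' = hom1 t * c'"
        unfolding cevian_eq[OF ne(1)] cevian_eq[OF ne(2)] by blast
      have "a = a' \<and> b = b' \<and> c = c'"
        using 1 2 by (intro bary_inject[OF nc]) (simp_all add: bary_rotate)
      with 1 2 show "X \<in> ?R" by blast
    qed
    show "?R \<subseteq> ?L"
    proof
      fix X assume "X \<in> ?R"
      then obtain a b c where 1: "X = bary A B C a b c" "a + b + c = 1"
        "hom0 s * c = hom1 s * b" "hom0 t * a = hom1 t * c" by blast
      moreover have "X = bary B C A b c a" "b + c + a = 1"
        using 1 by (simp_all add: bary_rotate)
      ultimately show "X \<in> ?L"
        unfolding cevian_eq[OF ne(1)] cevian_eq[OF ne(2)] by blast
    qed
  qed
qed

lemma cevians_meet:
  assumes nc: "\<not> collinear {A, B, C}" and D: "hden s t \<noteq> 0"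
  shows "cevian A B C s \<inter> cevian B C A t =
    {bary A B C (hom1 s * hom1 t / hden s t) (hom0 s * hom0 t / hden s t) (hom1 s * hom0 t / hden s t)}"
proof -
  have "a + b + c = 1 \<and> hom0 s * c = hom1 s * b \<and> hom0 t * a = hom1 t * c \<longleftrightarrow>
      a = hom1 s * hom1 t / hden s t \<and> b = hom0 s * hom0 t / hden s t \<and> c = hom1 s * hom0 t / hden s t"
    (is "?L \<longleftrightarrow> ?R") for a b c
  proof
    assume ?R
    moreover have "hom1 s * hom1 t + hom0 s * hom0 t + hom1 s * hom0 t = hden s t"
      by (simp add: hden_def)
    ultimately show ?L using D by (simp add: add_divide_distrib[symmetric])
  next
    assume ?L
    then have *: "a = 1 - b - c" "hom0 s * c = hom1 s * b" "hom0 t * a = hom1 t * c" by auto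
    \<comment> \<open>Cramer's rule for the normalisation and the two line equations, a system with
      determinant \<open>- hden s t\<close>.\<close>
    have "a * hden s t = hom1 s * hom1 t" "b * hden s t = hom0 s * hom0 t" "c * hden s t = hom1 s * hom0 t"
      using * unfolding hden_def by algebra+
    then show ?R using D by (simp add: eq_divide_eq)
  qed
  then show ?thesis unfolding cevians_Int[OF nc] by auto
qed

text \<open>If \<open>hden s t = 0\<close>, the homogeneous system has a nonzero solution, and
  adding it to a common point yields a second one.\<close>

lemma cevians_meet_once_iff:
  assumes nc: "\<not> collinear {A, B, C}"
  shows "(\<exists>!P. P \<in> cevian A B C s \<inter> cevian B C A t) \<longleftrightarrow> \<not> factor_vanishes s t"
proof (cases "hden s t = 0")
  case False
  then show ?thesis by (simp add: cevians_meet[OF nc] factor_vanishes_iff)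
next
  case True
  \<comment> \<open>a direction along which the solution of the two line equations is not determined\<close>
  obtain p q r where K: "p + q + r = 0" "hom0 s * r = hom1 s * q" "hom0 t * p = hom1 t * r"
    "p \<noteq> 0 \<or> q \<noteq> 0 \<or> r \<noteq> 0"
  \<comment> \<open>The unnormalised intersection coordinates have sum \<open>hden s t = 0\<close>
    and give the direction. They all vanish only for \<open>s\<close> zero and \<open>t\<close>
    infinite; then both cevians are the line \<open>AB\<close>, with direction
    \<open>A - B\<close>.\<close>
  proof (cases "hom1 s = 0 \<and> hom0 t = 0")
    case True
    then show ?thesis by (intro that[of 1 "-1" 0]) auto
  next
    case ne: False
    show ?thesis
    proof (rule that[of "hom1 s * hom1 t" "hom0 s * hom0 t" "hom1 s * hom0 t"])
      show "hom1 s * hom1 t + hom0 s * hom0 t + hom1 s * hom0 t = 0"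
        using True by (simp add: hden_def algebra_simps)
    qed (use ne hom_nonzero[of s] hom_nonzero[of t] in auto)
  qed
  have False if "\<exists>!P. P \<in> cevian A B C s \<inter> cevian B C A t"
  proof -
    from that obtain a b c where 1: "a + b + c = 1" "hom0 s * c = hom1 s * b" "hom0 t * a = hom1 t * c"
      and *: "bary A B C a b c \<in> cevian A B C s \<inter> cevian B C A t"
      unfolding cevians_Int[OF nc] by blast
    have 2: "a + p + (b + q) + (c + r) = 1" using 1 K by linarith
    moreover have "hom0 s * (c + r) = hom1 s * (b + q)" "hom0 t * (a + p) = hom1 t * (c + r)"
      using 1 K by (simp_all add: distrib_left)
    ultimately have "bary A B C (a + p) (b + q) (c + r) \<in> cevian A B C s \<inter> cevian B C A t"
      unfolding cevians_Int[OF nc] by blast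
    with that * have "bary A B C a b c = bary A B C (a + p) (b + q) (c + r)" by blast
    from bary_inject[OF nc this 1(1) 2] K(4) show False by simp
  qed
  then show ?thesis using True by (auto simp: factor_vanishes_iff)
qed

section \<open>Collinearity as a determinant\<close>

definition det3 ::
  "real \<Rightarrow> real \<Rightarrow> real \<Rightarrow> real \<Rightarrow> real \<Rightarrow> real \<Rightarrow> real \<Rightarrow> real \<Rightarrow> real \<Rightarrow> real" where
  "det3 a1 b1 c1 a2 b2 c2 a3 b3 c3 =
     a1 * (b2 * c3 - c2 * b3) - b1 * (a2 * c3 - c2 * a3) + c1 * (a2 * b3 - b2 * a3)"

text \<open>As each row sums to one, the determinant equals the 2 by 2 determinant of the
  \<open>b\<close> and \<open>c\<close> differences from the third point. It vanishes exactly when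
  these differences are proportional.\<close>

lemma collinear_bary_iff:
  assumes nc: "\<not> collinear {A, B, C}"
    and s: "a1 + b1 + c1 = 1" "a2 + b2 + c2 = 1" "a3 + b3 + c3 = 1"
  shows "collinear {bary A B C a1 b1 c1, bary A B C a2 b2 c2, bary A B C a3 b3 c3} \<longleftrightarrow>
    det3 a1 b1 c1 a2 b2 c2 a3 b3 c3 = 0"
proof -
  have a: "a1 = 1 - b1 - c1" "a2 = 1 - b2 - c2" "a3 = 1 - b3 - c3" using s by auto
  have det: "det3 a1 b1 c1 a2 b2 c2 a3 b3 c3 = (b1 - b3) * (c2 - c3) - (c1 - c3) * (b2 - b3)"
    unfolding det3_def a by algebra
  have comb: "bary A B C a2 b2 c2 = k *\<^sub>R bary A B C a1 b1 c1 + (1 - k) *\<^sub>R bary A B C a3 b3 c3 \<longleftrightarrow>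
     b2 - b3 = k * (b1 - b3) \<and> c2 - c3 = k * (c1 - c3)" for k
  proof -
    have "k *\<^sub>R bary A B C a1 b1 c1 + (1 - k) *\<^sub>R bary A B C a3 b3 c3 =
        bary A B C (k * a1 + (1 - k) * a3) (k * b1 + (1 - k) * b3) (k * c1 + (1 - k) * c3)"
      by (simp add: bary_def algebra_simps)
    moreover have "k * a1 + (1 - k) * a3 + (k * b1 + (1 - k) * b3) + (k * c1 + (1 - k) * c3) = 1"
      unfolding a by algebra
    ultimately have "bary A B C a2 b2 c2 = k *\<^sub>R bary A B C a1 b1 c1 + (1 - k) *\<^sub>R bary A B C a3 b3 c3 \<longleftrightarrow>
       a2 = k * a1 + (1 - k) * a3 \<and> b2 = k * b1 + (1 - k) * b3 \<and> c2 = k * c1 + (1 - k) * c3"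
      using bary_inject[OF nc _ s(2)] by metis
    also have "\<dots> \<longleftrightarrow> b2 - b3 = k * (b1 - b3) \<and> c2 - c3 = k * (c1 - c3)"
      unfolding a by (auto simp: algebra_simps)
    finally show ?thesis .
  qed
  have eq: "bary A B C a1 b1 c1 = bary A B C a3 b3 c3 \<longleftrightarrow> b1 = b3 \<and> c1 = c3"
    using bary_inject[OF nc _ s(1) s(3)] a by auto
  show ?thesis
    unfolding collinear_3_expand comb eq
  proof
    assume "b1 = b3 \<and> c1 = c3 \<or> (\<exists>k. b2 - b3 = k * (b1 - b3) \<and> c2 - c3 = k * (c1 - c3))"
    then show "det3 a1 b1 c1 a2 b2 c2 a3 b3 c3 = 0"
      using det by auto
  next
    assume "det3 a1 b1 c1 a2 b2 c2 a3 b3 c3 = 0"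
    then have 0: "(b2 - b3) * (c1 - c3) = (c2 - c3) * (b1 - b3)" using det by (simp add: mult.commute)
    show "b1 = b3 \<and> c1 = c3 \<or> (\<exists>k. b2 - b3 = k * (b1 - b3) \<and> c2 - c3 = k * (c1 - c3))"
    \<comment> \<open>The witness \<open>k\<close> is read off from a coordinate in which the first
      and third points differ; if there is none, they coincide.\<close>
    proof (cases "b1 = b3")
      case False
      then show ?thesis using 0
        by (intro disjI2 exI[of _ "(b2 - b3) / (b1 - b3)"]) (simp add: eq_divide_eq)
    next
      case True
      then show ?thesis using 0
        by (cases "c1 = c3") (auto intro!: exI[of _ "(c2 - c3) / (c1 - c3)"])
    qed
  qed
qed

section \<open>Limits of the parameters in homogeneous form\<close>

text \<open>A factor rescaling the homogeneous pair \<open>(1, t)\<close> so that it converges to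
  \<open>(hom0 s, hom1 s)\<close> as \<open>t\<close> tends to \<open>s\<close>.\<close>

definition chart :: "xreal \<Rightarrow> real \<Rightarrow> real" where
  "chart s t = (if s = None then 1 / t else 1)"

text \<open>At finite \<open>s\<close> the chart is 1 and \<open>f\<close> converges to a real
  number. At infinity the complements of balls are neighbourhoods, so \<open>f\<close> is unbounded
  in the limit, eventually nonzero, and the rescaled pair tends to \<open>(0, 1)\<close>.\<close>

lemma tendsto_chart:
  assumes "filterlim (\<lambda>q. Some (f q)) (nhdsin xreal_topology s) F"
  shows "((\<lambda>q. chart s (f q)) \<longlongrightarrow> hom0 s) F"
    and "((\<lambda>q. f q * chart s (f q)) \<longlongrightarrow> hom1 s) F"
    and "\<forall>\<^sub>F q in F. chart s (f q) \<noteq> 0"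
proof -
  have ev: "\<forall>\<^sub>F q in F. Some (f q) \<in> S" if "openin xreal_topology S" "s \<in> S" for S
  proof -
    have "\<forall>\<^sub>F t in nhdsin xreal_topology s. t \<in> S"
      using that by (auto simp: eventually_nhdsin)
    then show ?thesis using assms unfolding filterlim_iff by blast
  qed
  have "((\<lambda>q. chart s (f q)) \<longlongrightarrow> hom0 s) F \<and> ((\<lambda>q. f q * chart s (f q)) \<longlongrightarrow> hom1 s) F
    \<and> (\<forall>\<^sub>F q in F. chart s (f q) \<noteq> 0)"
  proof (cases s)
    case (Some a)
    have "(f \<longlongrightarrow> a) F"
    proof (rule topological_tendstoI)
      fix S :: "real set" assume "open S" "a \<in> S"
      then show "\<forall>\<^sub>F q in F. f q \<in> S"
        using ev[of "Some ` S"] Some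
        by (fastforce simp: openin_Alexandroff_compactification inj_image_mem_iff)
    qed
    then show ?thesis by (simp add: chart_def Some)
  next
    case None
    have "filterlim f at_infinity F"
      unfolding filterlim_at_infinity[OF order_refl]
    proof safe
      fix r :: real
      have "openin xreal_topology (insert None (Some ` (UNIV - cball 0 r)))"
        unfolding openin_Alexandroff_compactification
        by (intro disjI2 exI[of _ "cball 0 r"]) simp
      from ev[OF this] show "\<forall>\<^sub>F q in F. r \<le> norm (f q)"
        by (rule eventually_mono) (auto simp: None)
    qed
    then have 1: "((\<lambda>q. 1 / f q) \<longlongrightarrow> 0) F" and 2: "\<forall>\<^sub>F q in F. f q \<noteq> 0"
      using tendsto_divide_0 tendsto_const filterlim_at_infinity_imp_eventually_ne by blast+
    have "((\<lambda>q. f q * (1 / f q)) \<longlongrightarrow> 1) F"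
      by (rule tendsto_eventually, rule eventually_mono[OF 2]) simp
    with 1 2 show ?thesis by (simp add: chart_def None)
  qed
  then show "((\<lambda>q. chart s (f q)) \<longlongrightarrow> hom0 s) F"
    "((\<lambda>q. f q * chart s (f q)) \<longlongrightarrow> hom1 s) F" "\<forall>\<^sub>F q in F. chart s (f q) \<noteq> 0" by blast+
qed

lemma filterlim_nhdsin_continuous_map:
  assumes "continuous_map X Y g" "p \<in> topspace X"
  shows "filterlim g (nhdsin Y (g p)) (nhdsin X p)"
  unfolding filterlim_iff
proof safe
  fix P assume "eventually P (nhdsin Y (g p))"
  moreover have "g p \<in> topspace Y"
    using assms by (auto simp: continuous_map_def)
  ultimately obtain S where S: "openin Y S" "g p \<in> S" "\<forall>x\<in>S. P x"
    by (auto simp: eventually_nhdsin)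
  show "\<forall>\<^sub>F x in nhdsin X p. P (g x)"
    unfolding eventually_nhdsin using S assms
    by (intro disjI2 exI[of _ "{x \<in> topspace X. g x \<in> S}"])
      (auto intro: openin_continuous_map_preimage)
qed

lemma topspace_xreal_six: "topspace xreal_six_topology = UNIV"
proof -
  have "topspace xreal_topology = UNIV"
    by (auto simp: notin_range_Some)
  then show ?thesis unfolding topspace_prod_topology by simp
qed

lemma approach_component:
  assumes g: "continuous_map xreal_six_topology xreal_topology g" and f: "\<And>q. g (some6 q) = Some (f q)"
  shows "filterlim (\<lambda>q. Some (f q)) (nhdsin xreal_topology (g p)) (approach p)"
proof -
  have "filterlim some6 (nhdsin xreal_six_topology p) (approach p)"
    unfolding approach_def
    by (rule filterlim_mono[OF filterlim_filtercomap order_refl inf_le1])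
  moreover have "filterlim g (nhdsin xreal_topology (g p)) (nhdsin xreal_six_topology p)"
    by (rule filterlim_nhdsin_continuous_map[OF g])
      (simp only: topspace_xreal_six UNIV_I)
  ultimately have "filterlim (\<lambda>q. g (some6 q)) (nhdsin xreal_topology (g p)) (approach p)"
    by (rule filterlim_compose[rotated])
  then show ?thesis by (simp add: f)
qed

lemma some6_eq:
  "some6 q = (Some (fst q), Some (fst (snd q)), Some (fst (snd (snd q))),
    Some (fst (snd (snd (snd q)))), Some (fst (snd (snd (snd (snd q))))),
    Some (snd (snd (snd (snd (snd q))))))"
  by (cases q) (simp add: some6_def)

lemma approach_components:
  defines "T \<equiv> \<lambda>s f p. filterlim (\<lambda>q. Some (f q :: real)) (nhdsin xreal_topology s) (approach p)"
  shows "T x (\<lambda>q. fst q) (x, y, z, u, v, w)"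
    and "T y (\<lambda>q. fst (snd q)) (x, y, z, u, v, w)"
    and "T z (\<lambda>q. fst (snd (snd q))) (x, y, z, u, v, w)"
    and "T u (\<lambda>q. fst (snd (snd (snd q)))) (x, y, z, u, v, w)"
    and "T v (\<lambda>q. fst (snd (snd (snd (snd q))))) (x, y, z, u, v, w)"
    and "T w (\<lambda>q. snd (snd (snd (snd (snd q))))) (x, y, z, u, v, w)"
proof -
  let ?p = "(x, y, z, u, v, w)"
  have T: "T s f ?p"
    if "continuous_map xreal_six_topology xreal_topology g" "\<And>q. g (some6 q) = Some (f q)" "g ?p = s"
    for s f g
    using approach_component[OF that(1,2), of ?p] that(3) by (simp add: T_def)
  note c = continuous_map_id[unfolded id_def] continuous_map_fst_of[unfolded o_def] continuous_map_snd_of[unfolded o_def]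
  show "T x (\<lambda>q. fst q) ?p"
    by (rule T[where g = "\<lambda>q. fst q"]) (simp_all add: some6_eq continuous_map_fst)
  show "T y (\<lambda>q. fst (snd q)) ?p"
    by (rule T[where g = "\<lambda>q. fst (snd q)"], (rule c)+) (simp_all add: some6_eq)
  show "T z (\<lambda>q. fst (snd (snd q))) ?p"
    by (rule T[where g = "\<lambda>q. fst (snd (snd q))"], (rule c)+) (simp_all add: some6_eq)
  show "T u (\<lambda>q. fst (snd (snd (snd q)))) ?p"
    by (rule T[where g = "\<lambda>q. fst (snd (snd (snd q)))"], (rule c)+) (simp_all add: some6_eq)
  show "T v (\<lambda>q. fst (snd (snd (snd (snd q))))) ?p"
    by (rule T[where g = "\<lambda>q. fst (snd (snd (snd (snd q))))"], (rule c)+) (simp_all add: some6_eq)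
  show "T w (\<lambda>q. snd (snd (snd (snd (snd q))))) ?p"
    by (rule T[where g = "\<lambda>q. snd (snd (snd (snd (snd q))))"], (rule c)+) (simp_all add: some6_eq)
qed

section \<open>Density of the real tuples with nonzero denominator\<close>

text \<open>Nonempty open real sets are infinite and complements of compact sets are unbounded, so a
  bad real value can always be avoided.\<close>

lemma open_xreal_infinite:
  assumes "openin xreal_topology U" "s \<in> U"
  shows "infinite {r. Some r \<in> U}"
proof -
  from assms(1) consider (base) V where "open V" "U = Some ` V"
    | (ext) C where "compact C" "U = insert None (Some ` (UNIV - C))"
    by (auto simp: openin_Alexandroff_compactification)
  then show ?thesis
  proof cases
    case base
    then have "{r. Some r \<in> U} = V" "V \<noteq> {}" using assms by auto
    then show ?thesis using base finite_imp_not_open by auto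
  next
    case ext
    then have eq: "{r. Some r \<in> U} = UNIV - C" by auto
    show ?thesis
    proof
      assume "finite {r. Some r \<in> U}"
      then have "bounded (C \<union> (UNIV - C))"
        using ext(1) eq by (metis bounded_Un compact_imp_bounded finite_imp_bounded)
      then show False by simp
    qed
  qed
qed

lemma open_xreal_avoid:
  assumes "openin xreal_topology U" "s \<in> U"
  obtains r where "Some r \<in> U" "r \<noteq> k"
proof -
  have "\<not> {r. Some r \<in> U} \<subseteq> {k}"
    using open_xreal_infinite[OF assms] finite_subset by blast
  then show ?thesis using that by blast
qed

text \<open>For \<open>a \<noteq> 0\<close> the factor is a nonconstant affine function of
  \<open>b\<close> with the single zero \<open>- (1 + a) / a\<close>.\<close>

lemma open_xreal_pair:
  assumes "openin xreal_topology U" "s \<in> U" "openin xreal_topology V" "t \<in> V"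
  obtains a b where "Some a \<in> U" "Some b \<in> V" "1 + a + a * b \<noteq> 0"
proof -
  obtain a where a: "Some a \<in> U" "a \<noteq> 0" using open_xreal_avoid assms(1,2) by blast
  obtain b where b: "Some b \<in> V" "b \<noteq> - (1 + a) / a" using open_xreal_avoid assms(3,4) by blast
  then have "1 + a + a * b \<noteq> 0" using a(2) by (auto simp: field_simps)
  with a b that show ?thesis by blast
qed

lemma openin_prod_topologyE:
  assumes "openin (prod_topology X Y) S" "(x, y) \<in> S"
  obtains U V where "openin X U" "x \<in> U" "U \<times> V \<subseteq> S" "openin Y V" "y \<in> V"
  using assms unfolding openin_prod_topology_alt by blast

text \<open>Makes limits along \<open>approach p\<close> unique. Every box around \<open>p\<close>
  contains a real tuple with nonzero denominator, because the three factors involve disjoint pairs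
  of variables.\<close>

lemma approach_nontrivial: "approach p \<noteq> bot"
proof
  obtain x y z u v w where p: "p = (x, y, z, u, v, w)" by (cases p) auto
  assume "approach p = bot"
  then have "eventually (\<lambda>q. denom q = 0) (filtercomap some6 (nhdsin xreal_six_topology p))"
    by (simp add: approach_def trivial_limit_def eventually_inf_principal)
  then obtain Q where Q: "eventually Q (nhdsin xreal_six_topology p)" "\<And>q. Q (some6 q) \<Longrightarrow> denom q = 0"
    unfolding eventually_filtercomap by blast
  from Q(1) obtain S where S: "openin xreal_six_topology S" "(x, y, z, u, v, w) \<in> S"
    and "\<And>t. t \<in> S \<Longrightarrow> Q t"
    unfolding eventually_nhdsin p topspace_xreal_six by blast
  with Q(2) have S0: "\<And>q. some6 q \<in> S \<Longrightarrow> denom q = 0" by metis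
  \<comment> \<open>The open set is shrunk to a box one coordinate at a time, along the nested
    product.\<close>
  obtain U1 T1 where 1: "openin xreal_topology U1" "x \<in> U1" "U1 \<times> T1 \<subseteq> S"
    and T1: "openin (prod_topology xreal_topology (prod_topology xreal_topology
       (prod_topology xreal_topology (prod_topology xreal_topology xreal_topology)))) T1"
      "(y, z, u, v, w) \<in> T1"
    using S by (rule openin_prod_topologyE)
  obtain U2 T2 where 2: "openin xreal_topology U2" "y \<in> U2" "U2 \<times> T2 \<subseteq> T1"
    and T2: "openin (prod_topology xreal_topology
       (prod_topology xreal_topology (prod_topology xreal_topology xreal_topology))) T2"
      "(z, u, v, w) \<in> T2"
    using T1 by (rule openin_prod_topologyE)
  obtain U3 T3 where 3: "openin xreal_topology U3" "z \<in> U3" "U3 \<times> T3 \<subseteq> T2"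
    and T3: "openin (prod_topology xreal_topology (prod_topology xreal_topology xreal_topology)) T3"
      "(u, v, w) \<in> T3"
    using T2 by (rule openin_prod_topologyE)
  obtain U4 T4 where 4: "openin xreal_topology U4" "u \<in> U4" "U4 \<times> T4 \<subseteq> T3"
    and T4: "openin (prod_topology xreal_topology xreal_topology) T4" "(v, w) \<in> T4"
    using T3 by (rule openin_prod_topologyE)
  obtain U5 U6 where 5: "openin xreal_topology U5" "v \<in> U5" "U5 \<times> U6 \<subseteq> T4"
    and 6: "openin xreal_topology U6" "w \<in> U6"
    using T4 by (rule openin_prod_topologyE)
  obtain a e where ae: "Some a \<in> U1" "Some e \<in> U5" "1 + a + a * e \<noteq> 0"
    using open_xreal_pair 1(1,2) 5(1,2) by blast
  obtain b f where bf: "Some b \<in> U2" "Some f \<in> U6" "1 + b + b * f \<noteq> 0"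
    using open_xreal_pair 2(1,2) 6 by blast
  obtain c d where cd: "Some c \<in> U3" "Some d \<in> U4" "1 + c + c * d \<noteq> 0"
    using open_xreal_pair 3(1,2) 4(1,2) by blast
  have "(Some e, Some f) \<in> T4"
    using ae bf 5(3) by blast
  then have "(Some c, Some d, Some e, Some f) \<in> T2"
    using cd 4(3) 3(3) by blast
  then have "some6 (a, b, c, d, e, f) \<in> S"
    using ae bf 2(3) 1(3) unfolding some6_def prod.case by blast
  then have "denom (a, b, c, d, e, f) = 0" by (rule S0)
  then show False using ae bf cd by (simp add: denom_def)
qed

section \<open>The quotient as a determinant and its extension\<close>

text \<open>The rows belong to \<open>P\<close>, \<open>Q\<close>, \<open>R\<close>; those of
  \<open>Q\<close> and \<open>R\<close> are shifted cyclically so that the columns refer to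
  \<open>A\<close>, \<open>B\<close>, \<open>C\<close>.\<close>

definition cevian_det :: "real \<Rightarrow> real \<Rightarrow> real \<Rightarrow> real \<Rightarrow> real \<Rightarrow> real \<Rightarrow> real \<Rightarrow> real \<Rightarrow>
    real \<Rightarrow> real \<Rightarrow> real \<Rightarrow> real \<Rightarrow> real" where
  "cevian_det x0 x1 y0 y1 z0 z1 u0 u1 v0 v1 w0 w1 =
    (let d = x0 * v0 + x1 * v0 + x1 * v1; e = y0 * w0 + y1 * w0 + y1 * w1; f = z0 * u0 + z1 * u0 + z1 * u1 in
     det3 (x1 * v1 / d) (x0 * v0 / d) (x1 * v0 / d)
          (y1 * w0 / e) (y1 * w1 / e) (y0 * w0 / e)
          (z0 * u0 / f) (z1 * u0 / f) (z1 * u1 / f))"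

lemma det3_divide:
  "det3 (a1 / d) (b1 / d) (c1 / d) (a2 / e) (b2 / e) (c2 / e) (a3 / f) (b3 / f) (c3 / f) =
    det3 a1 b1 c1 a2 b2 c2 a3 b3 c3 / (d * e * f)"
  by (simp add: det3_def divide_inverse algebra_simps)

text \<open>Rescaling the pairs multiplies the entries of a row and its normalising factor by the
  same product, so the scalars cancel.\<close>

lemma quotient_eq_cevian_det:
  assumes "denom (x, y, z, u, v, w) \<noteq> 0"
    and "kx \<noteq> 0" "ky \<noteq> 0" "kz \<noteq> 0" "ku \<noteq> 0" "kv \<noteq> 0" "kw \<noteq> 0"
  shows "numer (x, y, z, u, v, w) / denom (x, y, z, u, v, w) =
    cevian_det kx (x * kx) ky (y * ky) kz (z * kz) ku (u * ku) kv (v * kv) kw (w * kw)"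
proof -
  define d e f where "d = 1 + x + x * v" and "e = 1 + y + y * w" and "f = 1 + z + z * u"
  have D: "kx * kv + x * kx * kv + x * kx * (v * kv) = (kx * kv) * d"
    "ky * kw + y * ky * kw + y * ky * (w * kw) = (ky * kw) * e"
    "kz * ku + z * kz * ku + z * kz * (u * ku) = (kz * ku) * f"
    by (simp_all add: d_def e_def f_def algebra_simps)
  have "cevian_det kx (x * kx) ky (y * ky) kz (z * kz) ku (u * ku) kv (v * kv) kw (w * kw) =
    det3 (x * v / d) (1 / d) (x / d) (y / e) (y * w / e) (1 / e) (1 / f) (z / f) (z * u / f)"
    unfolding cevian_det_def D Let_def using assms(2-) by (simp add: mult_ac)
  also have "\<dots> = numer (x, y, z, u, v, w) / (d * e * f)"
    unfolding det3_divide by (simp add: det3_def numer_def algebra_simps)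
  finally show ?thesis by (simp add: denom_def d_def e_def f_def)
qed

definition limit_det :: "xreal \<Rightarrow> xreal \<Rightarrow> xreal \<Rightarrow> xreal \<Rightarrow> xreal \<Rightarrow> xreal \<Rightarrow> real" where
  "limit_det x y z u v w =
    cevian_det (hom0 x) (hom1 x) (hom0 y) (hom1 y) (hom0 z) (hom1 z)
      (hom0 u) (hom1 u) (hom0 v) (hom1 v) (hom0 w) (hom1 w)"

lemma tendsto_cevian_det:
  assumes "(x0 \<longlongrightarrow> x0') F" "(x1 \<longlongrightarrow> x1') F" "(y0 \<longlongrightarrow> y0') F"
    "(y1 \<longlongrightarrow> y1') F" "(z0 \<longlongrightarrow> z0') F" "(z1 \<longlongrightarrow> z1') F"
    "(u0 \<longlongrightarrow> u0') F" "(u1 \<longlongrightarrow> u1') F" "(v0 \<longlongrightarrow> v0') F"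
    "(v1 \<longlongrightarrow> v1') F" "(w0 \<longlongrightarrow> w0') F" "(w1 \<longlongrightarrow> w1') F"
    and "x0' * v0' + x1' * v0' + x1' * v1' \<noteq> 0" "y0' * w0' + y1' * w0' + y1' * w1' \<noteq> 0"
      "z0' * u0' + z1' * u0' + z1' * u1' \<noteq> 0"
  shows "((\<lambda>q. cevian_det (x0 q) (x1 q) (y0 q) (y1 q) (z0 q) (z1 q) (u0 q) (u1 q) (v0 q) (v1 q) (w0 q) (w1 q)) \<longlongrightarrow>
    cevian_det x0' x1' y0' y1' z0' z1' u0' u1' v0' v1' w0' w1') F"
  unfolding cevian_det_def det3_def Let_def by (intro tendsto_intros assms)

text \<open>Near the limit point the quotient is \<open>cevian_det\<close> of the charted pairs.
  These tend to the homogeneous coordinates, where the normalising factors are nonzero and the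
  determinant is continuous.\<close>

lemma quotient_extends:
  assumes "\<not> factor_vanishes x v" "\<not> factor_vanishes y w" "\<not> factor_vanishes z u"
  shows "quotient_extends_to (x, y, z, u, v, w) (limit_det x y z u v w)"
    (is "quotient_extends_to ?p ?l")
proof -
  note T = approach_components[where x = x and y = y and z = z and u = u and v = v and w = w]
  note nz = assms[unfolded factor_vanishes_iff hden_def]
  note t = T[THEN tendsto_chart(1)] T[THEN tendsto_chart(2)]
  define G where "G = (\<lambda>(a, b, c, d, e, f).
    cevian_det (chart x a) (a * chart x a) (chart y b) (b * chart y b) (chart z c) (c * chart z c)
      (chart u d) (d * chart u d) (chart v e) (e * chart v e) (chart w f) (f * chart w f))"
  have "(G \<longlongrightarrow> ?l) (approach ?p)"
    unfolding G_def case_prod_unfold limit_det_def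
    by (rule tendsto_cevian_det t nz)+
  moreover have "\<forall>\<^sub>F q in approach ?p. denom q \<noteq> 0"
    by (simp add: approach_def eventually_inf_principal)
  then have "\<forall>\<^sub>F q in approach ?p. G q = numer q / denom q"
    using T[THEN tendsto_chart(3)]
  proof eventually_elim
    case (elim q)
    then show ?case
      by (cases q) (auto simp: G_def intro!: quotient_eq_cevian_det[symmetric])
  qed
  ultimately show ?thesis
    unfolding quotient_extends_to_def by (rule Lim_transform_eventually)
qed

text \<open>With an infinite entry, the unique limit is \<open>limit_det\<close>; at a real tuple
  \<open>limit_det\<close> is the quotient itself, with nonzero denominator.\<close>

lemma equation_holds_iff:
  assumes nv: "\<not> factor_vanishes x v" "\<not> factor_vanishes y w" "\<not> factor_vanishes z u"
  shows "equation_holds (x, y, z, u, v, w) \<longleftrightarrow> limit_det x y z u v w = 0"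
    (is "equation_holds ?p \<longleftrightarrow> ?l = 0")
proof (cases "?p \<in> range some6")
  case False
  then show ?thesis
    using quotient_extends[OF nv] tendsto_unique[OF approach_nontrivial]
    by (auto simp: equation_holds_def quotient_extends_to_def)
next
  case True
  then obtain a b c d e f where p: "x = Some a" "y = Some b" "z = Some c" "u = Some d" "v = Some e" "w = Some f"
    by (auto simp: some6_def)
  have d: "denom (a, b, c, d, e, f) \<noteq> 0"
    using nv by (simp add: p denom_def)
  have "?l = numer (a, b, c, d, e, f) / denom (a, b, c, d, e, f)"
    using quotient_eq_cevian_det[OF d, of 1 1 1 1 1 1] by (simp add: p limit_det_def)
  moreover have "equation_holds ?p \<longleftrightarrow> numer (a, b, c, d, e, f) = 0"
    using True by (auto simp: equation_holds_def p some6_def)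
  ultimately show ?thesis using d by simp
qed

theorem mainTheorem2:
  fixes A B C :: "real^2" and x y z u v w :: xreal
  assumes "\<not> collinear {A, B, C}"
  shows
    "((\<exists>!P. P \<in> cevian A B C x \<inter> cevian B C A v) \<and>
      (\<exists>!Q. Q \<in> cevian B C A y \<inter> cevian C A B w) \<and>
      (\<exists>!R. R \<in> cevian C A B z \<inter> cevian A B C u)
      \<longleftrightarrow> \<not> factor_vanishes x v \<and> \<not> factor_vanishes y w \<and> \<not> factor_vanishes z u)
   \<and> (\<forall>P Q R.
        {P} = cevian A B C x \<inter> cevian B C A v \<and>
        {Q} = cevian B C A y \<inter> cevian C A B w \<and>
        {R} = cevian C A B z \<inter> cevian A B C u
        \<longrightarrow> (\<exists>!l. quotient_extends_to (x, y, z, u, v, w) l)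
          \<and> (collinear {P, Q, R} \<longleftrightarrow> equation_holds (x, y, z, u, v, w)))"
proof (intro conjI allI impI)
  \<comment> \<open>The three cyclic vertex orders serve \<open>P\<close>, \<open>Q\<close> and
    \<open>R\<close> in turn.\<close>
  note nc = assms not_collinear_rotate[OF assms] not_collinear_rotate[OF not_collinear_rotate[OF assms]]
  note once = nc[THEN cevians_meet_once_iff]
  show "(\<exists>!P. P \<in> cevian A B C x \<inter> cevian B C A v) \<and>
      (\<exists>!Q. Q \<in> cevian B C A y \<inter> cevian C A B w) \<and>
      (\<exists>!R. R \<in> cevian C A B z \<inter> cevian A B C u)
      \<longleftrightarrow> \<not> factor_vanishes x v \<and> \<not> factor_vanishes y w \<and> \<not> factor_vanishes z u"
    unfolding once ..
  fix P Q R
  assume PQR: "{P} = cevian A B C x \<inter> cevian B C A v \<and>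
        {Q} = cevian B C A y \<inter> cevian C A B w \<and>
        {R} = cevian C A B z \<inter> cevian A B C u"
  then have nv: "\<not> factor_vanishes x v" "\<not> factor_vanishes y w" "\<not> factor_vanishes z u"
    using once by (metis singleton_iff)+
  from quotient_extends[OF nv] show "\<exists>!l. quotient_extends_to (x, y, z, u, v, w) l"
    using tendsto_unique[OF approach_nontrivial] by (auto simp: quotient_extends_to_def)
  have D: "hden x v \<noteq> 0" "hden y w \<noteq> 0" "hden z u \<noteq> 0"
    using nv by (simp_all add: factor_vanishes_iff)
  have "P = bary A B C (hom1 x * hom1 v / hden x v) (hom0 x * hom0 v / hden x v) (hom1 x * hom0 v / hden x v)"
    using PQR cevians_meet[OF nc(1) D(1)] by auto
  moreover have "Q = bary A B C (hom1 y * hom0 w / hden y w) (hom1 y * hom1 w / hden y w) (hom0 y * hom0 w / hden y w)"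
    using PQR cevians_meet[OF nc(2) D(2)] by (auto simp: bary_rotate)
  moreover have "R = bary A B C (hom0 z * hom0 u / hden z u) (hom1 z * hom0 u / hden z u) (hom1 z * hom1 u / hden z u)"
    using PQR cevians_meet[OF nc(3) D(3)] by (auto simp: bary_rotate[of C] bary_rotate)
  \<comment> \<open>Each coordinate triple sums to \<open>hden\<close> divided by itself, so the
    determinant criterion applies.\<close>
  ultimately have "collinear {P, Q, R} \<longleftrightarrow> limit_det x y z u v w = 0"
    unfolding limit_det_def cevian_det_def Let_def
    by (simp only: hden_def[symmetric], intro collinear_bary_iff[OF assms])
      (use D in \<open>simp_all add: hden_def add_divide_distrib[symmetric] add_ac\<close>)
  then show "collinear {P, Q, R} \<longleftrightarrow> equation_holds (x, y, z, u, v, w)"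
    by (simp add: equation_holds_iff[OF nv])
qed

end
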